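(* Let $0<\alpha<1$ and $0\leq \beta <1$. If $f\in \mathcal{S}^*(\beta)$, then $f$ is Booth lemniscate starlike of order $\alpha$ in the disc of radius $R_{\mathcal{BS}(\alpha)}(\mathcal{S}^{*}(\beta))$, where the $\mathcal{BS}(\alpha)$-radius of the class $\mathcal{S}^*(\beta)$ is $$R_{\mathcal{BS}(\alpha)}(\mathcal{S}^{*}(\beta))=\begin{cases}\dfrac{2\sqrt{\alpha}}{(1+\alpha)\sqrt{ 1+16\alpha (1-\beta)^2}}, & 0\leq \beta<\max\left\{0,\ \dfrac{9\alpha-1}{8\alpha}\right\},\\[3mm] \dfrac{1}{1+2(1-\alpha)(1- \beta)}, & \max\left\{0,\ \dfrac{9\alpha-1}{8\alpha}\right\}\leq \beta< 1.\end{cases}$$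
   Context: $\mathbb{D}=\{z\in\mathbb{C}:|z|<1\}$. $\mathcal{A}$ is the class of analytic functions $f$ on $\mathbb{D}$ with $f(0)=0$, $f'(0)=1$. For analytic $p,q$ on $\mathbb{D}$, $p\prec q$ (subordination) means $p=q\circ w$ for some analytic $w:\mathbb{D}\to\mathbb{D}$ with $w(0)=0$. The expression $zf'(z)/f(z)$ takes the value $1$ at $z=0$; in conditions on it, it is understood to be analytic. For $0\le\alpha<1$, $G_\alpha(z)=1+\dfrac{z}{1-\alpha z^2}$ on $\mathbb{D}$, and $\mathcal{BS}(\alpha)$, the class of Booth lemniscate starlike functions of order $\alpha$, consists of the $f\in\mathcal{A}$ with $zf'(z)/f(z)\prec G_\alpha(z)$. For a class $\mathcal{M}\subseteq\mathcal{A}$ and $f\in\mathcal{M}$ let $$R_f=\sup\left\{r\in(0,1): \frac{zf'(z)}{f(z)}\in G_\alpha(\mathbb{D})\text{ for all }|z|\le r\right\},\qquad R_{\mathcal{BS}(\alpha)}(\mathcal{M})=\inf\{R_f: f\in\mathcal{M}\}.$$ The number $R_{\mathcal{BS}(\alpha)}(\mathcal{M})$ is called the $\mathcal{BS}(\alpha)$-radius (Booth lemniscate starlikeness radius of order $\alpha$) of $\mathcal{M}$. That $f$ is Booth lemniscate starlike of order $\alpha$ in the disc of radius $R$ means that $z\mapsto f(rz)/r$ belongs to $\mathcal{BS}(\alpha)$ for every $0<r\le R$. For $0\le\beta<1$, $\mathcal{S}^*(\beta)$ is the class of starlike functions of order $\beta$: the $f\in\mathcal{A}$ with $\operatorname{Re}\left(zf'(z)/f(z)\right)>\beta$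 for all $z\in\mathbb{D}$. *)

theory Defs
  imports "HOL-Complex_Analysis.Complex_Analysis"
begin

text \<open>
  The open unit disc is \<open>ball 0 1\<close>. Functions on it are total functions on the complex plane whose
  values outside \<open>ball 0 1\<close> are irrelevant.
\<close>

definition normalized_analytic :: "(complex \<Rightarrow> complex) set" where
  "normalized_analytic = {f. f holomorphic_on ball 0 1 \<and> f 0 = 0 \<and> deriv f 0 = 1}"

definition subordinate :: "(complex \<Rightarrow> complex) \<Rightarrow> (complex \<Rightarrow> complex) \<Rightarrow> bool" where
  "subordinate p q \<longleftrightarrow>
     p holomorphic_on ball 0 1 \<and> q holomorphic_on ball 0 1 \<and>
     (\<exists>w. w holomorphic_on ball 0 1 \<and> w ` ball 0 1 \<subseteq> ball 0 1 \<and> w 0 = 0 \<and>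
          (\<forall>z\<in>ball 0 1. p z = q (w z)))"

text \<open>
  The expression $z f'(z) / f(z)$, with its limit value $1$ at the origin. At a zero $z \neq 0$ of
  \<open>f\<close> division by zero gives the value \<open>0\<close>, but there the function has a pole and is not analytic.
  As $0$ lies in the range of \<open>booth_fun \<alpha>\<close> for \<open>0 < \<alpha> < 1\<close>, analyticity is demanded explicitly below.
\<close>

definition starlike_quot :: "(complex \<Rightarrow> complex) \<Rightarrow> complex \<Rightarrow> complex" where
  "starlike_quot f z = (if z = 0 then 1 else z * deriv f z / f z)"

definition booth_fun :: "real \<Rightarrow> complex \<Rightarrow> complex" where
  "booth_fun \<alpha> z = 1 + z / (1 - of_real \<alpha> * z\<^sup>2)"

definition booth_starlike :: "real \<Rightarrow> (complex \<Rightarrow> complex) set" where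
  "booth_starlike \<alpha> = {f \<in> normalized_analytic. subordinate (starlike_quot f) (booth_fun \<alpha>)}"

definition booth_starlike_in_disc :: "real \<Rightarrow> real \<Rightarrow> (complex \<Rightarrow> complex) \<Rightarrow> bool" where
  "booth_starlike_in_disc \<alpha> R f \<longleftrightarrow>
     (\<forall>r. 0 < r \<and> r \<le> R \<longrightarrow> (\<lambda>z. f (of_real r * z) / of_real r) \<in> booth_starlike \<alpha>)"

definition booth_radius_of :: "real \<Rightarrow> (complex \<Rightarrow> complex) \<Rightarrow> real" where
  "booth_radius_of \<alpha> f =
     Sup {r. 0 < r \<and> r < 1 \<and> starlike_quot f analytic_on cball 0 r \<and>
             (\<forall>z. norm z \<le> r \<longrightarrow> starlike_quot f z \<in> booth_fun \<alpha> ` ball 0 1)}"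

definition booth_radius :: "real \<Rightarrow> (complex \<Rightarrow> complex) set \<Rightarrow> real" where
  "booth_radius \<alpha> M = Inf (booth_radius_of \<alpha> ` M)"

definition starlike_of_order :: "real \<Rightarrow> (complex \<Rightarrow> complex) set" where
  "starlike_of_order \<beta> =
     {f \<in> normalized_analytic. starlike_quot f holomorphic_on ball 0 1 \<and>
        (\<forall>z\<in>ball 0 1. Re (starlike_quot f z) > \<beta>)}"

end

theory Submission
  imports Defs
begin

text \<open>
  Write \<open>p z = z * f' z / f z\<close> and pass to \<open>v = 1 / (p z - 1)\<close>. Since
  \<open>1 / (booth_fun \<alpha> \<zeta> - 1) = 1 / \<zeta> - \<alpha> * \<zeta>\<close> is a Joukowski map, \<open>p z\<close> lies in the Booth domain
  iff \<open>v\<close> lies outside the closed ellipse with semi-axes \<open>1 - \<alpha>\<close> and \<open>1 + \<alpha>\<close>. On the other hand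
  \<open>p z = 1 + b * \<omega> / (1 - \<omega>)\<close> with \<open>b = 2 * (1 - \<beta>)\<close> and \<open>norm \<omega> \<le> norm z\<close> by Schwarz's lemma,
  that is, \<open>1 + b * v = 1 / \<omega>\<close>. The radius is therefore the reciprocal of the maximum of
  \<open>norm (1 + b * v)\<close> over the ellipse, and it is attained by the Koebe-type function
  \<open>z / (1 - z) powr b\<close>, for which \<open>\<omega> = z\<close>.
\<close>

section \<open>The Booth domain as the exterior of an ellipse\<close>

text \<open>The circles \<open>s = 1\<close> and \<open>s = 1 / \<alpha>\<^sup>2\<close> are the
  ones that the Joukowski map sends onto the ellipse; the factors \<open>1 - s\<close> and
  \<open>1 - \<alpha>\<^sup>2 * s\<close> record the distance from them.\<close>

lemma booth_ellipse_identity: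
  fixes \<alpha> :: real and \<zeta> v :: complex
  assumes "0 < \<alpha>" and "\<alpha> < 1" and "\<zeta> \<noteq> 0" and v: "v = 1 / \<zeta> - of_real \<alpha> * \<zeta>"
  defines "s \<equiv> (norm \<zeta>)\<^sup>2"
  shows "s\<^sup>2 * ((Re v / (1 - \<alpha>))\<^sup>2 + (Im v / (1 + \<alpha>))\<^sup>2 - 1) =
           (1 - s) * (1 - \<alpha>\<^sup>2 * s) * ((Re \<zeta> / (1 - \<alpha>))\<^sup>2 + (Im \<zeta> / (1 + \<alpha>))\<^sup>2)"
proof -
  let ?x = "Re \<zeta>" and ?y = "Im \<zeta>"
  have s: "s = ?x\<^sup>2 + ?y\<^sup>2" by (simp add: s_def cmod_power2)
  have s0: "s > 0" using \<open>\<zeta> \<noteq> 0\<close> by (simp add: s_def)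
  have re: "s * Re v = (1 - \<alpha> * s) * ?x"
  proof -
    have "Re v = ?x / s - \<alpha> * ?x" by (simp add: v s Re_divide)
    then show ?thesis using s0 by (simp add: field_simps)
  qed
  have im: "s * Im v = - ((1 + \<alpha> * s) * ?y)"
  proof -
    have "Im v = - ?y / s - \<alpha> * ?y" by (simp add: v s Im_divide)
    then show ?thesis using s0 by (simp add: field_simps)
  qed
  have a: "1 - \<alpha> \<noteq> 0" "1 + \<alpha> \<noteq> 0" using assms by auto
  have "s\<^sup>2 * ((Re v / (1 - \<alpha>))\<^sup>2 + (Im v / (1 + \<alpha>))\<^sup>2 - 1) =
      (s * Re v)\<^sup>2 / (1 - \<alpha>)\<^sup>2 + (s * Im v)\<^sup>2 / (1 + \<alpha>)\<^sup>2 - s * (?x\<^sup>2 + ?y\<^sup>2)"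
    unfolding s[symmetric]
    by (simp add: power_mult_distrib power_divide right_diff_distrib distrib_left power2_eq_square[of s])
  also have "s * (?x\<^sup>2 + ?y\<^sup>2) =
      s * (1 - \<alpha>)\<^sup>2 * (?x / (1 - \<alpha>))\<^sup>2 + s * (1 + \<alpha>)\<^sup>2 * (?y / (1 + \<alpha>))\<^sup>2"
    using a by (simp add: power_divide distrib_left)
  also have "(s * Re v)\<^sup>2 / (1 - \<alpha>)\<^sup>2 = (1 - \<alpha> * s)\<^sup>2 * (?x / (1 - \<alpha>))\<^sup>2"
    unfolding re by (simp add: power_mult_distrib power_divide)
  also have "(s * Im v)\<^sup>2 / (1 + \<alpha>)\<^sup>2 = (1 + \<alpha> * s)\<^sup>2 * (?y / (1 + \<alpha>))\<^sup>2"
    unfolding im by (simp add: power_mult_distrib power_divide)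
  \<comment> \<open>The coefficients of \<open>X\<close> and \<open>Y\<close> differ only in the
    sign of \<alpha>, and in both the terms \<open>2 * \<alpha> * s\<close> cancel, leaving the same
    product.\<close>
  also have "(1 - \<alpha> * s)\<^sup>2 * X + (1 + \<alpha> * s)\<^sup>2 * Y - (s * (1 - \<alpha>)\<^sup>2 * X + s * (1 + \<alpha>)\<^sup>2 * Y) =
      (1 - s) * (1 - \<alpha>\<^sup>2 * s) * (X + Y)" for X Y
    by (simp add: power2_eq_square algebra_simps)
  finally show ?thesis .
qed

text \<open>The last factor of the identity is positive, so only the radial product decides. It is
  positive iff \<open>norm \<zeta> < 1\<close> or
  \<open>norm \<zeta> > 1 / \<alpha>\<close>.\<close>

lemma booth_ellipse_iff:
  fixes \<alpha> :: real and \<zeta> v :: complex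
  assumes "0 < \<alpha>" and "\<alpha> < 1" and "\<zeta> \<noteq> 0" and "v = 1 / \<zeta> - of_real \<alpha> * \<zeta>"
  shows "1 < (Re v / (1 - \<alpha>))\<^sup>2 + (Im v / (1 + \<alpha>))\<^sup>2 \<longleftrightarrow>
           0 < (1 - (norm \<zeta>)\<^sup>2) * (1 - \<alpha>\<^sup>2 * (norm \<zeta>)\<^sup>2)"
proof -
  have "Re \<zeta> \<noteq> 0 \<or> Im \<zeta> \<noteq> 0" using \<open>\<zeta> \<noteq> 0\<close> by (auto simp: complex_eq_iff)
  then have "0 < (Re \<zeta> / (1 - \<alpha>))\<^sup>2 + (Im \<zeta> / (1 + \<alpha>))\<^sup>2"
    using assms by (simp add: sum_power2_gt_zero_iff)
  moreover have "0 < ((norm \<zeta>)\<^sup>2)\<^sup>2" using \<open>\<zeta> \<noteq> 0\<close> by simp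
  moreover have "1 < e \<longleftrightarrow> 0 < p" if "a * (e - 1) = p * q" "0 < a" "0 < q" for a e p q :: real
  proof -
    have "0 < a * (e - 1) \<longleftrightarrow> 0 < p * q" using that(1) by simp
    then show ?thesis using that(2,3) by (simp add: zero_less_mult_iff)
  qed
  ultimately show ?thesis using booth_ellipse_identity[OF assms] by blast
qed

lemma booth_denom_nonzero:
  assumes "0 < \<alpha>" and "\<alpha> < 1" and "norm z < 1"
  shows "1 - of_real \<alpha> * z\<^sup>2 \<noteq> (0::complex)"
proof
  assume "1 - of_real \<alpha> * z\<^sup>2 = 0"
  then have "norm (of_real \<alpha> * z\<^sup>2) = 1" by (metis eq_iff_diff_eq_0 norm_one)
  then have "\<alpha> * (norm z)\<^sup>2 = 1" using assms by (simp add: norm_mult norm_power)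
  moreover have "\<alpha> * (norm z)\<^sup>2 \<le> \<alpha> * 1"
    using assms by (intro mult_left_mono power_le_one) auto
  ultimately show False using assms by simp
qed

lemma booth_fun_image_iff:
  fixes \<alpha> :: real and v :: complex
  assumes \<alpha>: "0 < \<alpha>" "\<alpha> < 1" and "v \<noteq> 0"
  shows "1 + 1 / v \<in> booth_fun \<alpha> ` ball 0 1 \<longleftrightarrow>
           1 < (Re v / (1 - \<alpha>))\<^sup>2 + (Im v / (1 + \<alpha>))\<^sup>2"
proof
  assume "1 + 1 / v \<in> booth_fun \<alpha> ` ball 0 1"
  then obtain \<zeta> where \<zeta>: "norm \<zeta> < 1" "1 / v = \<zeta> / (1 - of_real \<alpha> * \<zeta>\<^sup>2)"
    by (auto simp: booth_fun_def)
  have "\<zeta> \<noteq> 0" using \<zeta> \<open>v \<noteq> 0\<close> by auto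
  have "v = 1 / \<zeta> - of_real \<alpha> * \<zeta>"
    using \<zeta>(2) \<open>\<zeta> \<noteq> 0\<close> \<open>v \<noteq> 0\<close> booth_denom_nonzero[OF \<alpha> \<zeta>(1)]
    by (simp add: field_simps power2_eq_square)
  moreover have "(norm \<zeta>)\<^sup>2 < 1" using \<zeta> by (simp add: abs_square_less_1)
  moreover have "\<alpha>\<^sup>2 * (norm \<zeta>)\<^sup>2 < 1"
  proof -
    have "\<alpha> * norm \<zeta> < 1" using \<alpha> \<zeta> mult_strict_mono'[of \<alpha> 1 "norm \<zeta>" 1] by simp
    then show ?thesis using \<alpha> by (simp add: abs_square_less_1 flip: power_mult_distrib)
  qed
  ultimately show "1 < (Re v / (1 - \<alpha>))\<^sup>2 + (Im v / (1 + \<alpha>))\<^sup>2"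
    using booth_ellipse_iff[OF \<alpha> \<open>\<zeta> \<noteq> 0\<close>] by simp
next
  assume E: "1 < (Re v / (1 - \<alpha>))\<^sup>2 + (Im v / (1 + \<alpha>))\<^sup>2"
  \<comment> \<open>A root of \<open>\<alpha> * \<zeta>\<^sup>2 + v * \<zeta> = 1\<close>, that is,
    a preimage of \<open>v\<close> under the Joukowski map. It need not be the one in the
    disc.\<close>
  define \<zeta> where "\<zeta> = (csqrt (v\<^sup>2 + 4 * of_real \<alpha>) - v) / (2 * of_real \<alpha>)"
  have "2 * of_real \<alpha> * \<zeta> + v = csqrt (v\<^sup>2 + 4 * of_real \<alpha>)"
    using \<alpha> by (simp add: \<zeta>_def)
  then have "(2 * of_real \<alpha> * \<zeta> + v)\<^sup>2 = v\<^sup>2 + 4 * of_real \<alpha>" by simp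
  then have "4 * of_real \<alpha> * (of_real \<alpha> * \<zeta>\<^sup>2 + v * \<zeta> - 1) = 0"
    by (simp add: power2_eq_square algebra_simps)
  then have root: "of_real \<alpha> * \<zeta>\<^sup>2 + v * \<zeta> = 1" using \<alpha> by simp
  then have "\<zeta> \<noteq> 0" by auto
  have v: "v = 1 / \<zeta> - of_real \<alpha> * \<zeta>"
    using root \<open>\<zeta> \<noteq> 0\<close> by (simp add: field_simps power2_eq_square)
  have pos: "0 < (1 - (norm \<zeta>)\<^sup>2) * (1 - \<alpha>\<^sup>2 * (norm \<zeta>)\<^sup>2)"
    using E booth_ellipse_iff[OF \<alpha> \<open>\<zeta> \<noteq> 0\<close> v] by simp
  \<comment> \<open>The two roots have product \<open>- 1 / \<alpha>\<close>. If the chosen one is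
    not in the disc, \<open>pos\<close> forces its norm above \<open>1 / \<alpha>\<close>, so the
    other root is in the disc.\<close>
  have "\<exists>\<xi>. norm \<xi> < 1 \<and> \<xi> \<noteq> 0 \<and> v = 1 / \<xi> - of_real \<alpha> * \<xi>"
  proof (cases "norm \<zeta> < 1")
    case True
    then show ?thesis using \<open>\<zeta> \<noteq> 0\<close> v by blast
  next
    case False
    then have "1 \<le> (norm \<zeta>)\<^sup>2" by simp
    then have "1 < (\<alpha> * norm \<zeta>)\<^sup>2"
      using pos by (simp add: zero_less_mult_iff power_mult_distrib)
    then have "1 < \<alpha> * norm \<zeta>"
      using \<alpha> power_less_imp_less_base[of 1 2 "\<alpha> * norm \<zeta>"] by simp
    then have "norm (- 1 / (of_real \<alpha> * \<zeta>)) < 1"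
      using \<alpha> by (simp add: norm_divide norm_mult)
    moreover have "v = 1 / (- 1 / (of_real \<alpha> * \<zeta>)) - of_real \<alpha> * (- 1 / (of_real \<alpha> * \<zeta>))"
      using v \<alpha> by (simp add: field_simps)
    ultimately show ?thesis using \<alpha> \<open>\<zeta> \<noteq> 0\<close>
      by (intro exI[of _ "- 1 / (of_real \<alpha> * \<zeta>)"]) auto
  qed
  then obtain \<xi> where \<xi>: "norm \<xi> < 1" "\<xi> \<noteq> 0" "v = 1 / \<xi> - of_real \<alpha> * \<xi>" by blast
  have "v = (1 - of_real \<alpha> * \<xi>\<^sup>2) / \<xi>"
    using \<xi> by (simp add: field_simps power2_eq_square)
  then have "1 + 1 / v = booth_fun \<alpha> \<xi>"
    by (simp add: booth_fun_def)
  then show "1 + 1 / v \<in> booth_fun \<alpha> ` ball 0 1" using \<xi> by auto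
qed

section \<open>Univalence and subordination\<close>

lemma booth_fun_holomorphic:
  assumes "0 < \<alpha>" and "\<alpha> < 1"
  shows "booth_fun \<alpha> holomorphic_on ball 0 1"
  unfolding booth_fun_def using booth_denom_nonzero[OF assms]
  by (intro holomorphic_intros) auto

text \<open>Two points with equal values either coincide or satisfy
  \<open>\<alpha> * x * y = - 1\<close>, which is too large a product for points of the
  disc.\<close>

lemma inj_on_booth_fun:
  assumes \<alpha>: "0 < \<alpha>" "\<alpha> < 1"
  shows "inj_on (booth_fun \<alpha>) (ball 0 1)"
proof (rule inj_onI)
  fix x y :: complex assume xy: "x \<in> ball 0 1" "y \<in> ball 0 1" "booth_fun \<alpha> x = booth_fun \<alpha> y"
  have "x * (1 - of_real \<alpha> * y\<^sup>2) = y * (1 - of_real \<alpha> * x\<^sup>2)"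
    using xy booth_denom_nonzero[OF \<alpha>, of x] booth_denom_nonzero[OF \<alpha>, of y]
    by (simp add: booth_fun_def frac_eq_eq)
  then have "(x - y) * (1 + of_real \<alpha> * (x * y)) = 0"
    by (simp add: power2_eq_square algebra_simps)
  moreover have "1 + of_real \<alpha> * (x * y) \<noteq> 0"
  proof
    assume "1 + of_real \<alpha> * (x * y) = 0"
    then have "norm (of_real \<alpha> * (x * y)) = 1" by (metis add_eq_0_iff norm_minus_cancel norm_one)
    then have "\<alpha> * (norm x * norm y) = 1" using \<alpha> by (simp add: norm_mult)
    moreover have "\<alpha> * (norm x * norm y) \<le> \<alpha> * 1"
      using \<alpha> xy by (intro mult_left_mono mult_le_one) auto
    ultimately show False using \<alpha> by simp
  qed
  ultimately show "x = y" by simp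
qed

text \<open>Univalence of \<open>booth_fun \<alpha>\<close> reduces subordination to an inclusion of ranges.\<close>

lemma subordinate_booth_funI:
  assumes \<alpha>: "0 < \<alpha>" "\<alpha> < 1" and p: "p holomorphic_on ball 0 1" "p 0 = 1"
    and sub: "p ` ball 0 1 \<subseteq> booth_fun \<alpha> ` ball 0 1"
  shows "subordinate p (booth_fun \<alpha>)"
proof -
  obtain g where g: "g holomorphic_on booth_fun \<alpha> ` ball 0 1"
      "\<And>z. z \<in> ball 0 1 \<Longrightarrow> g (booth_fun \<alpha> z) = z"
    using holomorphic_has_inverse[OF booth_fun_holomorphic[OF \<alpha>] open_ball inj_on_booth_fun[OF \<alpha>]]
    by metis
  have "g \<circ> p holomorphic_on ball 0 1"
    using holomorphic_on_compose_gen[OF p(1) g(1) sub] .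
  moreover have "(g \<circ> p) ` ball 0 1 \<subseteq> ball 0 1" using sub g(2) by fastforce
  moreover have "(g \<circ> p) 0 = 0"
    using g(2)[of 0] p(2) by (simp add: booth_fun_def)
  moreover have "\<forall>z\<in>ball 0 1. p z = booth_fun \<alpha> ((g \<circ> p) z)" using sub g(2) by fastforce
  ultimately show ?thesis
    unfolding subordinate_def using p booth_fun_holomorphic[OF \<alpha>] by blast
qed

section \<open>The half-plane condition and its extremal function\<close>

text \<open>The point \<open>1 - b = 2 * \<beta> - 1\<close> is the mirror image of 1 in the line
  \<open>Re = \<beta>\<close>. The half-plane consists of the points closer to 1, so the quotient
  \<open>W\<close> of the two displacements maps into the disc and Schwarz's lemma applies.\<close>

lemma half_plane_subordination:
  assumes p: "p holomorphic_on ball 0 1" "p 0 = 1" and re: "\<And>z. norm z < 1 \<Longrightarrow> \<beta> < Re (p z)"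
    and \<beta>: "\<beta> < 1" and z: "norm z < 1"
  obtains \<omega> where "norm \<omega> \<le> norm z" and "p z = 1 + 2 * of_real (1 - \<beta>) * \<omega> / (1 - \<omega>)"
proof -
  define b :: real where "b = 2 * (1 - \<beta>)"
  define W where "W = (\<lambda>z. (p z - 1) / (p z - 1 + of_real b))"
  have ne: "p z - 1 + of_real b \<noteq> 0" if "norm z < 1" for z
    using re[OF that] \<beta> by (auto simp: b_def complex_eq_iff)
  have "W holomorphic_on ball 0 1"
    unfolding W_def using ne p by (intro holomorphic_intros) auto
  moreover have "W 0 = 0" by (simp add: W_def p)
  moreover have "norm (W z) < 1" if "norm z < 1" for z
  proof -
    have "0 < b * (2 * (Re (p z) - \<beta>))" using re[OF that] \<beta> by (simp add: b_def)
    then have "(norm (p z - 1))\<^sup>2 < (norm (p z - 1 + of_real b))\<^sup>2"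
      unfolding cmod_power2 by (simp add: b_def power2_eq_square algebra_simps)
    then have "norm (p z - 1) < norm (p z - 1 + of_real b)"
      by (rule power2_less_imp_less) simp
    then show ?thesis using ne[OF that] by (simp add: W_def norm_divide)
  qed
  ultimately have "norm (W z) \<le> norm z" using Schwarz_Lemma(1)[of W z] z by simp
  moreover have "p z = 1 + of_real b * W z / (1 - W z)"
  proof -
    have "1 - W z = of_real b / (p z - 1 + of_real b)"
      using ne[OF z] by (simp add: W_def field_simps)
    then show ?thesis using ne[OF z] \<beta> by (simp add: W_def b_def)
  qed
  ultimately show ?thesis using that[of "W z"] by (simp add: b_def)
qed

lemma starlike_extremal:
  fixes \<beta> :: real
  assumes "\<beta> < 1"
  obtains f where "f \<in> starlike_of_order \<beta>"
    and "\<And>z. norm z < 1 \<Longrightarrow> starlike_quot f z = 1 + 2 * of_real (1 - \<beta>) * z / (1 - z)"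
proof -
  define b :: complex where "b = 2 * of_real (1 - \<beta>)"
  \<comment> \<open>The exponential is the principal power of \<open>1 - z\<close> with exponent
    \<open>- b\<close>; it is holomorphic because \<open>1 - z\<close> stays in the right
    half-plane.\<close>
  define f where "f = (\<lambda>z. z * exp (- b * Ln (1 - z)))"
  have dom: "1 - z \<notin> \<real>\<^sub>\<le>\<^sub>0" "1 - z \<noteq> 0" if "norm z < 1" for z :: complex
  proof -
    have "Re z < 1" using that complex_Re_le_cmod[of z] by linarith
    then show "1 - z \<notin> \<real>\<^sub>\<le>\<^sub>0" "1 - z \<noteq> 0" by (auto simp: complex_nonpos_Reals_iff complex_eq_iff)
  qed
  have deriv: "deriv f z = exp (- b * Ln (1 - z)) * (1 + b * z / (1 - z))" if "norm z < 1" for z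
    unfolding f_def
    by (rule DERIV_imp_deriv, (rule derivative_eq_intros dom that refl)+)
      (use dom[OF that] in \<open>simp add: field_simps\<close>)
  have quot: "starlike_quot f z = 1 + b * z / (1 - z)" if "norm z < 1" for z
    using deriv[OF that] by (simp add: starlike_quot_def f_def)
  have "f holomorphic_on ball 0 1"
    unfolding f_def using dom by (intro holomorphic_intros) auto
  moreover have "f 0 = 0" "deriv f 0 = 1" by (simp_all add: deriv) (simp add: f_def)
  moreover have "starlike_quot f holomorphic_on ball 0 1"
  proof -
    have "(\<lambda>z. 1 + b * z / (1 - z)) holomorphic_on ball 0 1"
      using dom by (intro holomorphic_intros) auto
    then show ?thesis using quot by (subst holomorphic_cong[OF refl]) auto
  qed
  moreover have "\<beta> < Re (starlike_quot f z)" if z: "norm z < 1" for z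
  proof -
    have "z / (1 - z) = 1 / (1 - z) - 1" using dom[OF z] by (simp add: field_simps)
    \<comment> \<open>Inversion maps the disc of radius 1 about 1 into the half-plane
      \<open>Re > 1 / 2\<close>: with \<open>u = 1 - z\<close>, the disc says that the squared norm
      of \<open>u\<close> is below \<open>2 * Re u\<close>.\<close>
    moreover have "1 / 2 < Re (1 / (1 - z))"
    proof -
      have "(Re z)\<^sup>2 + (Im z)\<^sup>2 < 1" using z by (simp add: abs_square_less_1 flip: cmod_power2)
      then have "(Re (1 - z))\<^sup>2 + (Im (1 - z))\<^sup>2 < 2 * Re (1 - z)"
        by (simp add: power2_eq_square algebra_simps)
      moreover have "0 < (Re (1 - z))\<^sup>2 + (Im (1 - z))\<^sup>2"
        using dom(2)[OF z] by (metis cmod_power2 zero_less_norm_iff zero_less_power)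
      ultimately show ?thesis by (simp add: Re_divide field_simps)
    qed
    ultimately have "- 1 / 2 < Re (z / (1 - z))" by simp
    have "\<beta> - 1 = 2 * (1 - \<beta>) * (- 1 / 2)" by (simp add: field_simps)
    also have "\<dots> < 2 * (1 - \<beta>) * Re (z / (1 - z))"
      using assms \<open>- 1 / 2 < Re (z / (1 - z))\<close> by (intro mult_strict_left_mono) auto
    also have "\<dots> = Re (of_real (2 * (1 - \<beta>)) * (z / (1 - z)))" by (simp only: Re_complex_of_real Im_complex_of_real times_complex.sel)
    also have "\<dots> = Re (b * z / (1 - z))" by (simp add: b_def)
    finally show ?thesis by (simp add: quot[OF z])
  qed
  ultimately have "f \<in> starlike_of_order \<beta>"
    by (auto simp: starlike_of_order_def normalized_analytic_def)
  then show ?thesis using that[of f] quot by (simp add: b_def)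
qed

section \<open>The farthest point of the ellipse\<close>

text \<open>For \<open>c\<close> in \<open>{-1..1}\<close> this is the squared norm of
  \<open>1 + b * v\<close> at the boundary points with real part \<open>(1 - \<alpha>) * c\<close>;
  \<open>c\<close> is the cosine of the usual ellipse parameter.\<close>

definition ellipse_dist2 :: "real \<Rightarrow> real \<Rightarrow> real \<Rightarrow> real" where
  "ellipse_dist2 \<alpha> b c = (1 + b * (1 - \<alpha>) * c)\<^sup>2 + b\<^sup>2 * (1 + \<alpha>)\<^sup>2 * (1 - c\<^sup>2)"

text \<open>Moving \<open>v\<close> vertically to the boundary keeps \<open>Re v\<close> and does
  not decrease the modulus of \<open>Im v\<close>, so boundary points suffice.\<close>

lemma ellipse_dist2_bound:
  fixes v :: complex
  assumes \<alpha>: "0 < \<alpha>" "\<alpha> < 1" and E: "(Re v / (1 - \<alpha>))\<^sup>2 + (Im v / (1 + \<alpha>))\<^sup>2 \<le> 1"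
  obtains c where "c \<in> {-1..1}" and "(norm (1 + of_real b * v))\<^sup>2 \<le> ellipse_dist2 \<alpha> b c"
proof
  let ?c = "Re v / (1 - \<alpha>)"
  have "?c\<^sup>2 \<le> 1" using E zero_le_power2[of "Im v / (1 + \<alpha>)"] by linarith
  then show "?c \<in> {-1..1}" using abs_square_le_1[of ?c] by (auto simp only: abs_le_iff atLeastAtMost_iff)
  have "(Im v)\<^sup>2 \<le> (1 + \<alpha>)\<^sup>2 * (1 - ?c\<^sup>2)"
    using E \<alpha> by (simp add: power_divide field_simps)
  then have "b\<^sup>2 * (Im v)\<^sup>2 \<le> b\<^sup>2 * ((1 + \<alpha>)\<^sup>2 * (1 - ?c\<^sup>2))"
    by (rule mult_left_mono) simp
  then show "(norm (1 + of_real b * v))\<^sup>2 \<le> ellipse_dist2 \<alpha> b ?c"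
    using \<alpha> by (simp add: cmod_power2 ellipse_dist2_def power_mult_distrib mult.assoc)
qed

lemma ellipse_dist2_attained:
  assumes \<alpha>: "0 < \<alpha>" "\<alpha> < 1" and c: "c \<in> {-1..1}"
  obtains v :: complex where "(Re v / (1 - \<alpha>))\<^sup>2 + (Im v / (1 + \<alpha>))\<^sup>2 = 1"
    and "(norm (1 + of_real b * v))\<^sup>2 = ellipse_dist2 \<alpha> b c"
proof
  let ?v = "Complex ((1 - \<alpha>) * c) ((1 + \<alpha>) * sqrt (1 - c\<^sup>2))"
  have "c\<^sup>2 \<le> 1" using c by (simp add: abs_square_le_1 abs_le_iff)
  then show "(Re ?v / (1 - \<alpha>))\<^sup>2 + (Im ?v / (1 + \<alpha>))\<^sup>2 = 1"
    and "(norm (1 + of_real b * ?v))\<^sup>2 = ellipse_dist2 \<alpha> b c"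
    using \<alpha> by (simp_all add: cmod_power2 ellipse_dist2_def power_mult_distrib mult.assoc)
qed

text \<open>As a function of \<open>c\<close>, the squared distance is a concave parabola with vertex
  \<open>(1 - \<alpha>) / (4 * \<alpha> * b)\<close>, where \<open>b = 2 * (1 - \<beta>)\<close>. The two cases of the radius
  formula correspond to this vertex lying in \<open>{0<..<1}\<close> or not.\<close>

lemma ellipse_dist2_max:
  fixes \<alpha> \<beta> :: real
  assumes \<alpha>: "0 < \<alpha>" "\<alpha> < 1" and \<beta>: "0 \<le> \<beta>" "\<beta> < 1"
  defines "R \<equiv> if \<beta> < max 0 ((9 * \<alpha> - 1) / (8 * \<alpha>))
            then 2 * sqrt \<alpha> / ((1 + \<alpha>) * sqrt (1 + 16 * \<alpha> * (1 - \<beta>)\<^sup>2))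
            else 1 / (1 + 2 * (1 - \<alpha>) * (1 - \<beta>))"
  shows "0 < R" and "R < 1"
    and "\<And>c. c \<in> {-1..1} \<Longrightarrow> ellipse_dist2 \<alpha> (2 * (1 - \<beta>)) c \<le> (1 / R)\<^sup>2"
    and "\<exists>c\<in>{-1..1}. ellipse_dist2 \<alpha> (2 * (1 - \<beta>)) c = (1 / R)\<^sup>2"
proof -
  define b where "b = 2 * (1 - \<beta>)"
  have b: "0 < b" using \<beta> by (simp add: b_def)
  have "0 < 1 + 16 * \<alpha> * (1 - \<beta>)\<^sup>2" using \<alpha> by (simp add: add_pos_nonneg)
  moreover have "0 < 1 + 2 * (1 - \<alpha>) * (1 - \<beta>)" using \<alpha> \<beta> by (simp add: add_pos_nonneg)
  ultimately show R0: "0 < R" using \<alpha> by (simp add: R_def)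
  have "(\<forall>c\<in>{-1..1}. ellipse_dist2 \<alpha> b c \<le> (1 / R)\<^sup>2) \<and>
      (\<exists>c\<in>{-1..1}. ellipse_dist2 \<alpha> b c = (1 / R)\<^sup>2)"
  proof (cases "\<beta> < max 0 ((9 * \<alpha> - 1) / (8 * \<alpha>))")
    case True
    define c0 where "c0 = (1 - \<alpha>) / (4 * \<alpha> * b)"
    have "\<beta> < (9 * \<alpha> - 1) / (8 * \<alpha>)" using True \<beta> by linarith
    \<comment> \<open>The case condition, rewritten, puts the vertex \<open>c0\<close> to the left
      of 1.\<close>
    then have "1 - \<alpha> < 4 * \<alpha> * b" using \<alpha> by (simp add: b_def field_simps)
    then have c0: "c0 \<in> {-1..1}" using \<alpha> b by (simp add: c0_def field_simps)
    have R: "(1 / R)\<^sup>2 = (1 + \<alpha>)\<^sup>2 * (1 + 4 * \<alpha> * b\<^sup>2) / (4 * \<alpha>)"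
    proof -
      have "16 * \<alpha> * (1 - \<beta>)\<^sup>2 = 4 * \<alpha> * b\<^sup>2" by (simp add: b_def power2_eq_square algebra_simps)
      then show ?thesis
        using True \<alpha> \<open>0 < 1 + 16 * \<alpha> * (1 - \<beta>)\<^sup>2\<close>
        by (simp add: R_def power_divide power_mult_distrib)
    qed
    have "4 * \<alpha> * b * c0 = 1 - \<alpha>" using \<alpha> b by (simp add: c0_def)
    then have "4 * \<alpha> * b * c - (1 - \<alpha>) = 4 * \<alpha> * b * (c - c0)" for c
      by (simp add: right_diff_distrib)
    then have "4 * \<alpha> * (4 * \<alpha> * b\<^sup>2 * (c - c0)\<^sup>2) = (4 * \<alpha> * b * c - (1 - \<alpha>))\<^sup>2" for c
      by (simp add: power2_eq_square)
    \<comment> \<open>Completing the square, multiplied through by \<open>4 * \<alpha>\<close> to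
      clear denominators.\<close>
    then have "4 * \<alpha> * ellipse_dist2 \<alpha> b c =
        4 * \<alpha> * ((1 + \<alpha>)\<^sup>2 * (1 + 4 * \<alpha> * b\<^sup>2) / (4 * \<alpha>) - 4 * \<alpha> * b\<^sup>2 * (c - c0)\<^sup>2)" for c
      using \<alpha> by (simp add: ellipse_dist2_def right_diff_distrib) (simp add: power2_eq_square algebra_simps)
    then have "ellipse_dist2 \<alpha> b c = (1 / R)\<^sup>2 - 4 * \<alpha> * b\<^sup>2 * (c - c0)\<^sup>2" for c
      using \<alpha> unfolding R by simp
    then show ?thesis using c0 \<alpha> by auto
  next
    case False
    then have "(9 * \<alpha> - 1) / (8 * \<alpha>) \<le> \<beta>" by simp
    \<comment> \<open>Now the vertex is at or beyond 1, so the maximum over \<open>{-1..1}\<close>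
      is at \<open>c = 1\<close>.\<close>
    then have "4 * \<alpha> * b \<le> 1 - \<alpha>" using \<alpha> by (simp add: b_def field_simps)
    have R: "(1 / R)\<^sup>2 = (1 + b * (1 - \<alpha>))\<^sup>2"
    proof -
      have "2 * (1 - \<alpha>) * (1 - \<beta>) = b * (1 - \<alpha>)" by (simp add: b_def algebra_simps)
      then show ?thesis using False by (simp add: R_def)
    qed
    have "ellipse_dist2 \<alpha> b c \<le> (1 / R)\<^sup>2" if c: "c \<in> {-1..1}" for c
    proof -
      have "(4 * \<alpha> * b) * (1 + c) \<le> (1 - \<alpha>) * 2"
        using \<open>4 * \<alpha> * b \<le> 1 - \<alpha>\<close> c \<alpha> by (intro mult_mono) auto
      \<comment> \<open>The difference between the value at 1 and the value at \<open>c\<close>,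
        with its root \<open>c = 1\<close> factored out.\<close>
      then have "0 \<le> b * (1 - c) * ((1 - \<alpha>) * 2 - (4 * \<alpha> * b) * (1 + c))"
        using b c by simp
      also have "\<dots> = (1 / R)\<^sup>2 - ellipse_dist2 \<alpha> b c"
        unfolding R ellipse_dist2_def by (simp add: power2_eq_square algebra_simps)
      finally show ?thesis by simp
    qed
    moreover have "ellipse_dist2 \<alpha> b 1 = (1 / R)\<^sup>2" by (simp add: R ellipse_dist2_def)
    ultimately show ?thesis by force
  qed
  then show bound: "\<And>c. c \<in> {-1..1} \<Longrightarrow> ellipse_dist2 \<alpha> (2 * (1 - \<beta>)) c \<le> (1 / R)\<^sup>2"
    and "\<exists>c\<in>{-1..1}. ellipse_dist2 \<alpha> (2 * (1 - \<beta>)) c = (1 / R)\<^sup>2"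
    by (auto simp: b_def)
  \<comment> \<open>In both cases the value at \<open>c = 1\<close> already exceeds 1 and bounds the
    maximum from below.\<close>
  have "1 < (1 + b * (1 - \<alpha>))\<^sup>2" using \<alpha> b by (simp add: one_less_power)
  also have "\<dots> \<le> (1 / R)\<^sup>2" using bound[of 1] by (simp add: ellipse_dist2_def b_def)
  finally have "R\<^sup>2 < 1" using R0 by (simp add: power_divide field_simps)
  then show "R < 1" using R0 by (simp add: abs_square_less_1)
qed

section \<open>Inclusion, sharpness and the radius\<close>

lemma starlike_quot_in_booth:
  assumes \<alpha>: "0 < \<alpha>" "\<alpha> < 1" and "\<beta> < 1" and f: "f \<in> starlike_of_order \<beta>"
    and R: "0 < R" "R \<le> 1"
    and bound: "\<And>c. c \<in> {-1..1} \<Longrightarrow> ellipse_dist2 \<alpha> (2 * (1 - \<beta>)) c \<le> (1 / R)\<^sup>2"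
    and z: "norm z < R"
  shows "starlike_quot f z \<in> booth_fun \<alpha> ` ball 0 1"
proof -
  define b where "b = 2 * (1 - \<beta>)"
  have b: "0 < b" using \<open>\<beta> < 1\<close> by (simp add: b_def)
  have "norm z < 1" using z R by simp
  moreover have "starlike_quot f 0 = 1" by (simp add: starlike_quot_def)
  ultimately obtain \<omega> where \<omega>: "norm \<omega> \<le> norm z"
      "starlike_quot f z = 1 + 2 * of_real (1 - \<beta>) * \<omega> / (1 - \<omega>)"
    using f \<open>\<beta> < 1\<close> half_plane_subordination[of "starlike_quot f" \<beta> z]
    by (auto simp: starlike_of_order_def)
  show ?thesis
  \<comment> \<open>\<open>\<omega> = 0\<close> corresponds to \<open>v\<close> at infinity, where
    the quotient is 1, the value of \<open>booth_fun\<close> at 0.\<close>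
  proof (cases "\<omega> = 0")
    case True
    then have "starlike_quot f z = booth_fun \<alpha> 0" by (simp add: \<omega>(2) booth_fun_def)
    then show ?thesis by auto
  next
    case False
    define v where "v = (1 - \<omega>) / (of_real b * \<omega>)"
    have "\<omega> \<noteq> 1" using \<omega>(1) \<open>norm z < 1\<close> by auto
    then have "v \<noteq> 0" using False b by (simp add: v_def)
    have "1 + of_real b * v = 1 / \<omega>" using False b by (simp add: v_def field_simps)
    moreover have "1 / R < 1 / norm \<omega>"
      using \<omega>(1) z False R by (intro divide_strict_left_mono) auto
    ultimately have big: "(1 / R)\<^sup>2 < (norm (1 + of_real b * v))\<^sup>2"
      using R by (intro power_strict_mono) (auto simp: norm_divide)
    have "1 < (Re v / (1 - \<alpha>))\<^sup>2 + (Im v / (1 + \<alpha>))\<^sup>2"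
    proof (rule ccontr)
      assume "\<not> ?thesis"
      then obtain c where "c \<in> {-1..1}" "(norm (1 + of_real b * v))\<^sup>2 \<le> ellipse_dist2 \<alpha> b c"
        using ellipse_dist2_bound[OF \<alpha>, of v b] by force
      then show False using bound[of c] big by (simp add: b_def)
    qed
    then have "1 + 1 / v \<in> booth_fun \<alpha> ` ball 0 1"
      using booth_fun_image_iff[OF \<alpha> \<open>v \<noteq> 0\<close>] by simp
    moreover have "starlike_quot f z = 1 + 1 / v" by (simp add: \<omega>(2) v_def b_def)
    ultimately show ?thesis by simp
  qed
qed

text \<open>Solving \<open>1 + b * v = 1 / z\<close> at a farthest ellipse point \<open>v\<close>
  gives a point of norm \<open>R\<close>; the ellipse itself is excluded from the domain of
  admissible \<open>v\<close>.\<close>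

lemma starlike_extremal_not_in_booth:
  fixes R :: real
  assumes \<alpha>: "0 < \<alpha>" "\<alpha> < 1" and "\<beta> < 1" and R: "0 < R" "R < 1"
    and c: "c \<in> {-1..1}" "ellipse_dist2 \<alpha> (2 * (1 - \<beta>)) c = (1 / R)\<^sup>2"
  obtains z :: complex where "norm z = R"
    and "1 + 2 * of_real (1 - \<beta>) * z / (1 - z) \<notin> booth_fun \<alpha> ` ball 0 1"
proof -
  define b where "b = 2 * (1 - \<beta>)"
  have b: "0 < b" using \<open>\<beta> < 1\<close> by (simp add: b_def)
  obtain v where v: "(Re v / (1 - \<alpha>))\<^sup>2 + (Im v / (1 + \<alpha>))\<^sup>2 = 1"
      "(norm (1 + of_real b * v))\<^sup>2 = ellipse_dist2 \<alpha> b c"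
    using ellipse_dist2_attained[OF \<alpha> c(1), of b] by metis
  have "v \<noteq> 0" using v(1) by auto
  define z where "z = 1 / (1 + of_real b * v)"
  have "norm (1 + of_real b * v) = 1 / R"
    using v(2) c(2) R by (simp add: b_def power2_eq_iff_nonneg)
  then have "norm z = R" by (simp add: z_def norm_divide)
  have "1 + of_real b * v \<noteq> 0" using \<open>norm z = R\<close> R by (auto simp: z_def)
  then have "z / (1 - z) = 1 / (of_real b * v)"
    using b \<open>v \<noteq> 0\<close> by (simp add: z_def field_simps)
  then have "of_real b * (z / (1 - z)) = 1 / v" using b by simp
  then have "1 + 2 * of_real (1 - \<beta>) * z / (1 - z) = 1 + 1 / v" by (simp add: b_def)
  also have "\<dots> \<notin> booth_fun \<alpha> ` ball 0 1"
    using booth_fun_image_iff[OF \<alpha> \<open>v \<noteq> 0\<close>] v(1) by simp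
  finally show ?thesis using that \<open>norm z = R\<close> by blast
qed

text \<open>Dilation turns the quotient at \<open>z\<close> into the quotient of \<open>f\<close> at
  \<open>r * z\<close>. Only the open disc of radius \<open>r\<close> enters, so the radius itself
  is allowed as \<open>r\<close>.\<close>

lemma booth_starlike_dilation:
  assumes \<alpha>: "0 < \<alpha>" "\<alpha> < 1" and f: "f \<in> starlike_of_order \<beta>" and r: "0 < r" "r \<le> 1"
    and sub: "\<And>z. norm z < r \<Longrightarrow> starlike_quot f z \<in> booth_fun \<alpha> ` ball 0 1"
  shows "(\<lambda>z. f (of_real r * z) / of_real r) \<in> booth_starlike \<alpha>"
proof -
  define g where "g = (\<lambda>z. f (of_real r * z) / of_real r)"
  have rz: "norm (of_real r * z) < r" if "norm z < 1" for z :: complex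
    using that r by (simp add: norm_mult)
  have maps: "(\<lambda>z::complex. of_real r * z) ` ball 0 1 \<subseteq> ball 0 1"
  proof (rule image_subsetI)
    fix z :: complex assume "z \<in> ball 0 1"
    then show "of_real r * z \<in> ball 0 1" using rz[of z] r by simp
  qed
  have hol: "(\<lambda>z. h (of_real r * z)) holomorphic_on ball 0 1" if "h holomorphic_on ball 0 1" for h
  proof -
    have "(\<lambda>z. of_real r * z) holomorphic_on ball 0 1" by (intro holomorphic_intros)
    from holomorphic_on_compose_gen[OF this that maps] show ?thesis by (simp add: o_def)
  qed
  have f': "f holomorphic_on ball 0 1" "f 0 = 0" "deriv f 0 = 1"
      "starlike_quot f holomorphic_on ball 0 1"
    using f by (auto simp: starlike_of_order_def normalized_analytic_def)
  have deriv: "deriv g z = deriv f (of_real r * z)" if "norm z < 1" for z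
  proof -
    have "(f has_field_derivative deriv f (of_real r * z)) (at (of_real r * z))"
      using f'(1) rz[OF that] r by (intro holomorphic_derivI[OF _ open_ball]) auto
    moreover have "((\<lambda>z. of_real r * z) has_field_derivative of_real r) (at z)"
      by (auto intro!: derivative_eq_intros)
    ultimately have "((\<lambda>z. f (of_real r * z)) has_field_derivative
        deriv f (of_real r * z) * of_real r) (at z)"
      by (rule DERIV_chain2)
    from DERIV_cdivide[OF this, of "of_real r"] show ?thesis
      using r by (simp add: g_def DERIV_imp_deriv)
  qed
  have quot: "starlike_quot g z = starlike_quot f (of_real r * z)" if "norm z < 1" for z
    using deriv[OF that] r by (simp add: starlike_quot_def g_def)
  have "g holomorphic_on ball 0 1"
    unfolding g_def using hol[OF f'(1)] r by (intro holomorphic_intros) auto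
  then have "g \<in> normalized_analytic"
    using f' deriv[of 0] by (simp add: normalized_analytic_def g_def)
  moreover have "subordinate (starlike_quot g) (booth_fun \<alpha>)"
  proof (rule subordinate_booth_funI[OF \<alpha>])
    show "starlike_quot g holomorphic_on ball 0 1"
      using hol[OF f'(4)] quot by (subst holomorphic_cong[OF refl]) auto
    show "starlike_quot g 0 = 1" by (simp add: starlike_quot_def)
    show "starlike_quot g ` ball 0 1 \<subseteq> booth_fun \<alpha> ` ball 0 1"
      using quot sub[OF rz] by auto
  qed
  ultimately show ?thesis by (simp add: booth_starlike_def g_def)
qed

text \<open>\<open>booth_radius_of\<close> tests closed discs, whereas the inclusion is known on an
  open one; every smaller \<open>r\<close> is admissible, and density gives
  \<open>R\<close>.\<close>

lemma le_booth_radius_of: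
  assumes f: "f \<in> starlike_of_order \<beta>" and R: "0 < R" "R \<le> 1"
    and sub: "\<And>z. norm z < R \<Longrightarrow> starlike_quot f z \<in> booth_fun \<alpha> ` ball 0 1"
  shows "R \<le> booth_radius_of \<alpha> f"
proof (rule dense_le_bounded[OF R(1)])
  fix r assume r: "0 < r" "r < R"
  have "starlike_quot f analytic_on ball 0 1"
    using f by (simp add: starlike_of_order_def analytic_on_open)
  then have "starlike_quot f analytic_on cball 0 r"
    using r R by (elim analytic_on_subset) auto
  then show "r \<le> booth_radius_of \<alpha> f"
    unfolding booth_radius_of_def using r R sub
    by (intro cSup_upper bdd_aboveI[of _ 1]) auto
qed

lemma booth_radius_of_eq:
  assumes f: "f \<in> starlike_of_order \<beta>" and R: "0 < R" "R \<le> 1"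
    and sub: "\<And>z. norm z < R \<Longrightarrow> starlike_quot f z \<in> booth_fun \<alpha> ` ball 0 1"
    and z: "norm z = R" "starlike_quot f z \<notin> booth_fun \<alpha> ` ball 0 1"
  shows "booth_radius_of \<alpha> f = R"
proof (rule antisym)
  let ?S = "{r. 0 < r \<and> r < 1 \<and> starlike_quot f analytic_on cball 0 r \<and>
             (\<forall>z. norm z \<le> r \<longrightarrow> starlike_quot f z \<in> booth_fun \<alpha> ` ball 0 1)}"
  have "starlike_quot f analytic_on ball 0 1"
    using f by (simp add: starlike_of_order_def analytic_on_open)
  then have "starlike_quot f analytic_on cball 0 (R / 2)"
    using R by (elim analytic_on_subset) auto
  \<comment> \<open>A witness that the set is nonempty, as the least-upper-bound rule for
    \<open>Sup\<close> on the reals demands.\<close>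
  then have "R / 2 \<in> ?S" using R sub by auto
  then have "?S \<noteq> {}" by blast
  moreover have "r \<le> R" if "r \<in> ?S" for r
    using that z by (cases "r \<le> R") auto
  ultimately show "booth_radius_of \<alpha> f \<le> R"
    unfolding booth_radius_of_def by (rule cSup_least)
  show "R \<le> booth_radius_of \<alpha> f" using le_booth_radius_of[OF f R sub] .
qed

theorem theorem3p1:
  fixes \<alpha> \<beta> :: real
  assumes "0 < \<alpha>" and "\<alpha> < 1" and "0 \<le> \<beta>" and "\<beta> < 1"
  shows "(\<forall>f\<in>starlike_of_order \<beta>.
            booth_starlike_in_disc \<alpha> (booth_radius \<alpha> (starlike_of_order \<beta>)) f) \<and>
         booth_radius \<alpha> (starlike_of_order \<beta>) =
           (if \<beta> < max 0 ((9 * \<alpha> - 1) / (8 * \<alpha>))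
            then 2 * sqrt \<alpha> / ((1 + \<alpha>) * sqrt (1 + 16 * \<alpha> * (1 - \<beta>)\<^sup>2))
            else 1 / (1 + 2 * (1 - \<alpha>) * (1 - \<beta>)))"
    (is "_ \<and> ?radius = ?R")
proof -
  define R where "R = ?R"
  note max = ellipse_dist2_max[OF assms, folded R_def]
  have sub: "starlike_quot f z \<in> booth_fun \<alpha> ` ball 0 1"
    if "f \<in> starlike_of_order \<beta>" "norm z < R" for f z
    using starlike_quot_in_booth[OF assms(1,2,4) that(1) max(1) less_imp_le[OF max(2)] max(3) that(2)] .
  obtain f where f: "f \<in> starlike_of_order \<beta>"
      "\<And>z. norm z < 1 \<Longrightarrow> starlike_quot f z = 1 + 2 * of_real (1 - \<beta>) * z / (1 - z)"
    using starlike_extremal[OF assms(4)] by blast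
  obtain c where "c \<in> {-1..1}" "ellipse_dist2 \<alpha> (2 * (1 - \<beta>)) c = (1 / R)\<^sup>2"
    using max(4) by blast
  then obtain z where "norm z = R"
      "1 + 2 * of_real (1 - \<beta>) * z / (1 - z) \<notin> booth_fun \<alpha> ` ball 0 1"
    using starlike_extremal_not_in_booth[OF assms(1,2,4) max(1,2)] by blast
  then have "booth_radius_of \<alpha> f = R"
    using booth_radius_of_eq[OF f(1) max(1) less_imp_le[OF max(2)] sub[OF f(1)]] f(2) max(2)
    by metis
  \<comment> \<open>The infimum is a minimum: the extremal \<open>f\<close> attains
    \<open>R\<close>, and the inclusion on the open disc makes \<open>R\<close> a lower bound for
    the whole class.\<close>
  then have "?radius = R"
    unfolding booth_radius_def using f(1) max(1,2) sub
    by (intro cInf_eq_minimum) (auto intro!: le_booth_radius_of)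
  moreover have "booth_starlike_in_disc \<alpha> R g" if "g \<in> starlike_of_order \<beta>" for g
    unfolding booth_starlike_in_disc_def
    using booth_starlike_dilation[OF assms(1,2) that] sub[OF that] max(2) by auto
  ultimately show ?thesis by (simp add: R_def)
qed

end
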